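(* Let $G_0, G_1, G_2$ be finite graphs, each with a distinguished vertex $A$, such that for each $j\in\{0,1,2\}$ the sages win the hat guessing game on $G_j$ with the hint $A-1$. Let $G$ be the graph obtained from the disjoint union of $G_0$, $G_1$, $G_2$ and a single edge $P_2(AB)$ by identifying the distinguished vertices of $G_0,G_1,G_2$ and the endpoint $A$ of the edge into one vertex $A$ (so $B$ is a leaf adjacent to $A$). Then the sages win the hat guessing game on $G$ without any hints.
   Context: Hat guessing game: a sage sits at each vertex of a finite graph; hat colors are $H=\{0,1,2\}$; each sage sees only his neighbours' hats and guesses his own color by a deterministic function of the neighbours' colors, fixed in advance; a strategy is winning if for every hat placement at least one sage guesses correctly. Hint $A-1$: a color $i\in H$ is announced in advance to everyone and only placements $C$ with $C(A)\ne i$ occur; the sages win with this hint if for every announced $i$ there is a strategy such that every placement with $C(A)\ne i$ has a correct guess (by permuting color names, equivalent to this for a single $i$). *)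

theory Defs
  imports "Graph_Theory.Pair_Digraph" "HOL-Library.FuncSet"
begin

text \<open>
  Finite simple graphs are given by the locale predicate \<^const>\<open>pair_graph\<close>: finitely many
  vertices, and a symmetric irreflexive set of arcs, each edge being a pair of opposite arcs.
\<close>

definition hat_colors :: "nat set"
  where "hat_colors = {0, 1, 2}"

definition neighbours :: "'a pair_pre_digraph \<Rightarrow> 'a \<Rightarrow> 'a set"
  where "neighbours G v = {w. (v, w) \<in> parcs G}"

definition hat_placements :: "'a pair_pre_digraph \<Rightarrow> ('a \<Rightarrow> nat) set"
  where "hat_placements G = (pverts G \<rightarrow>\<^sub>E hat_colors)"

definition hat_strategies :: "'a pair_pre_digraph \<Rightarrow> ('a \<Rightarrow> ('a \<Rightarrow> nat) \<Rightarrow> nat) set"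
  where "hat_strategies G =
    {f. \<forall>v\<in>pverts G. f v \<in> (neighbours G v \<rightarrow>\<^sub>E hat_colors) \<rightarrow> hat_colors}"

definition guesses_correctly ::
    "'a pair_pre_digraph \<Rightarrow> ('a \<Rightarrow> ('a \<Rightarrow> nat) \<Rightarrow> nat) \<Rightarrow> ('a \<Rightarrow> nat) \<Rightarrow> 'a \<Rightarrow> bool"
  where "guesses_correctly G f C v \<longleftrightarrow> f v (restrict C (neighbours G v)) = C v"

definition sages_win :: "'a pair_pre_digraph \<Rightarrow> bool"
  where "sages_win G \<longleftrightarrow>
    (\<exists>f\<in>hat_strategies G. \<forall>C\<in>hat_placements G. \<exists>v\<in>pverts G. guesses_correctly G f C v)"

text \<open>The hint \<open>A - 1\<close>: the strategy may depend on the announced color \<open>i\<close>.\<close>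

definition sages_win_with_hint :: "'a pair_pre_digraph \<Rightarrow> 'a \<Rightarrow> bool"
  where "sages_win_with_hint G A \<longleftrightarrow>
    (\<forall>i\<in>hat_colors. \<exists>f\<in>hat_strategies G. \<forall>C\<in>hat_placements G.
       C A \<noteq> i \<longrightarrow> (\<exists>v\<in>pverts G. guesses_correctly G f C v))"

definition disjoint_union ::
    "'a pair_pre_digraph \<Rightarrow> 'b pair_pre_digraph \<Rightarrow> ('a + 'b) pair_pre_digraph" (infixr "\<oplus>\<^sub>G" 65)
  where "G \<oplus>\<^sub>G H =
    \<lparr> pverts = Inl ` pverts G \<union> Inr ` pverts H,
      parcs = map_prod Inl Inl ` parcs G \<union> map_prod Inr Inr ` parcs H \<rparr>"

definition single_edge :: "'a \<Rightarrow> 'a \<Rightarrow> 'a pair_pre_digraph"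
  where "single_edge a b = \<lparr> pverts = {a, b}, parcs = {(a, b), (b, a)} \<rparr>"

text \<open>
  Identification of all vertices in \<open>S\<close>; the resulting vertex is named \<open>r\<close>, which is meant to
  be an element of \<open>S\<close>.
\<close>

definition identify :: "'a set \<Rightarrow> 'a \<Rightarrow> 'a pair_pre_digraph \<Rightarrow> 'a pair_pre_digraph"
  where "identify S r G =
    (let q = (\<lambda>v. if v \<in> S then r else v)
     in \<lparr> pverts = q ` pverts G, parcs = map_prod q q ` parcs G \<rparr>)"

definition glue_with_leaf ::
    "'a pair_pre_digraph \<Rightarrow> 'a \<Rightarrow> 'b pair_pre_digraph \<Rightarrow> 'b \<Rightarrow> 'c pair_pre_digraph \<Rightarrow> 'c
      \<Rightarrow> 'd \<Rightarrow> 'd \<Rightarrow> ('a + 'b + 'c + 'd) pair_pre_digraph"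
  where "glue_with_leaf G0 A0 G1 A1 G2 A2 A B =
    identify {Inl A0, Inr (Inl A1), Inr (Inr (Inl A2)), Inr (Inr (Inr A))} (Inr (Inr (Inr A)))
      (G0 \<oplus>\<^sub>G G1 \<oplus>\<^sub>G G2 \<oplus>\<^sub>G single_edge A B)"

lemma pair_graph_disjoint_union:
  assumes "pair_graph G" "pair_graph H"
  shows "pair_graph (G \<oplus>\<^sub>G H)"
proof -
  interpret G: pair_graph G by fact
  interpret H: pair_graph H by fact
  have "sym (parcs G)" "sym (parcs H)"
    using G.pair_sym_arcs H.pair_sym_arcs by (auto simp: symmetric_def)
  then have "sym (parcs (G \<oplus>\<^sub>G H))"
    by (auto simp: disjoint_union_def intro!: symI dest: symD)
  then show ?thesis
    by unfold_locales
      (auto simp: disjoint_union_def symmetric_def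
        dest: G.in_arcsD1 G.in_arcsD2 H.in_arcsD1 H.in_arcsD2 G.pair_no_loops H.pair_no_loops)
qed

lemma pair_graph_single_edge: "a \<noteq> b \<Longrightarrow> pair_graph (single_edge a b)"
  by unfold_locales (auto simp: single_edge_def symmetric_def intro!: symI)

lemma pair_graph_identify:
  assumes "pair_graph G" "r \<in> S" and indep: "\<And>u v. u \<in> S \<Longrightarrow> v \<in> S \<Longrightarrow> (u, v) \<notin> parcs G"
  shows "pair_graph (identify S r G)"
proof -
  interpret G: pair_graph G by fact
  define q where "q = (\<lambda>v. if v \<in> S then r else v)"
  have verts: "pverts (identify S r G) = q ` pverts G"
    and arcs: "parcs (identify S r G) = map_prod q q ` parcs G"
    by (simp_all add: identify_def q_def Let_def)
  have "sym (parcs G)"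
    using G.pair_sym_arcs by (auto simp: symmetric_def)
  then have sym: "sym (map_prod q q ` parcs G)"
    by (fastforce intro!: symI dest: symD)
  have irrefl: "(v, v) \<notin> parcs G" for v
    using G.pair_no_loops[of "(v, v)"] by auto
  have loopfree: "q u \<noteq> q v" if "(u, v) \<in> parcs G" for u v
    using that irrefl indep \<open>r \<in> S\<close> by (auto simp: q_def split: if_splits)
  show ?thesis
    by unfold_locales
      (use sym loopfree in \<open>auto simp: verts arcs symmetric_def dest: G.in_arcsD1 G.in_arcsD2\<close>)
qed

lemma pair_graph_glue_with_leaf:
  assumes "pair_graph G0" "pair_graph G1" "pair_graph G2" "A \<noteq> B"
  shows "pair_graph (glue_with_leaf G0 A0 G1 A1 G2 A2 A B)"
  unfolding glue_with_leaf_def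
proof (rule pair_graph_identify)
  show "pair_graph (G0 \<oplus>\<^sub>G G1 \<oplus>\<^sub>G G2 \<oplus>\<^sub>G single_edge A B)"
    by (intro pair_graph_disjoint_union pair_graph_single_edge assms)
  have "(A0, A0) \<notin> parcs G0" "(A1, A1) \<notin> parcs G1" "(A2, A2) \<notin> parcs G2"
    using assms(1-3)[THEN pair_graph.axioms(1), THEN pair_digraph.axioms(2),
      THEN pair_loopfree_digraph.pair_no_loops] by fastforce+
  then show "(u, v) \<notin> parcs (G0 \<oplus>\<^sub>G G1 \<oplus>\<^sub>G G2 \<oplus>\<^sub>G single_edge A B)"
    if "u \<in> {Inl A0, Inr (Inl A1), Inr (Inr (Inl A2)), Inr (Inr (Inr A))}"
      "v \<in> {Inl A0, Inr (Inl A1), Inr (Inr (Inl A2)), Inr (Inr (Inr A))}" for u v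
    using that \<open>A \<noteq> B\<close> by (auto simp: disjoint_union_def single_edge_def)
qed simp

end

theory Submission
  imports Defs
begin

text \<open>
  Play on \<open>G\<^sub>j\<close> the strategy for the hint \<open>C(A) \<noteq> j\<close>. If nobody other than \<open>A\<close> guesses correctly
  and \<open>A\<close> has color \<open>a\<close>, then for each \<open>j \<noteq> a\<close> the strategy on \<open>G\<^sub>j\<close> would have let \<open>A\<close> guess
  \<open>a\<close>. So \<open>A\<close> guesses the color \<open>a\<close> that is proposed by \<open>G\<^sub>j\<close> for both \<open>j \<noteq> a\<close>. Such a color is
  unique: for two of them, the third index \<open>j\<close> would propose both.
\<close>

text \<open>The map \<open>e\<close> may fail to be injective. One operation thus covers both the
  gluing, which is a relabelling by a quotient map, and the embedded copies of \<open>G0\<close>,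
  \<open>G1\<close>, \<open>G2\<close>, so that gluing can be computed by composing maps.\<close>

definition relabel :: "('a \<Rightarrow> 'b) \<Rightarrow> 'a pair_pre_digraph \<Rightarrow> 'b pair_pre_digraph"
  where "relabel e G = \<lparr> pverts = e ` pverts G, parcs = map_prod e e ` parcs G \<rparr>"

lemma pverts_relabel [simp]: "pverts (relabel e G) = e ` pverts G"
  and parcs_relabel [simp]: "parcs (relabel e G) = map_prod e e ` parcs G"
  by (simp_all add: relabel_def)

lemma pair_wf_digraph_relabel:
  assumes "pair_wf_digraph G"
  shows "pair_wf_digraph (relabel e G)"
  using assms by (auto simp: pair_wf_digraph_def)

lemma neighbours_subset_pverts: "pair_wf_digraph G \<Longrightarrow> neighbours G v \<subseteq> pverts G"
  by (auto simp: neighbours_def dest: pair_wf_digraph.in_arcsD2)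

text \<open>Injectivity prevents another vertex with the same image from contributing arcs at
  \<open>e v\<close>.\<close>

lemma neighbours_relabel:
  assumes "pair_wf_digraph G" "inj_on e (pverts G)" "v \<in> pverts G"
  shows "neighbours (relabel e G) (e v) = e ` neighbours G v"
proof -
  have "u = v" if "(u, w) \<in> parcs G" "e u = e v" for u w
    using that assms by (meson inj_onD pair_wf_digraph.in_arcsD1)
  then show ?thesis
    by (force simp: neighbours_def image_iff)
qed

text \<open>The hinted graphs are given on separate vertex types. This transport along an
  isomorphism turns them into subgraphs of one graph, all with the same distinguished
  vertex.\<close>

lemma sages_win_with_hint_relabel:
  assumes wf: "pair_wf_digraph G" and inj: "inj_on e (pverts G)" and A: "A \<in> pverts G"
    and win: "sages_win_with_hint G A"
  shows "sages_win_with_hint (relabel e G) (e A)"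
  unfolding sages_win_with_hint_def
proof
  fix i assume "i \<in> hat_colors"
  with win obtain f where f: "f \<in> hat_strategies G"
    and f_win: "\<And>C. C \<in> hat_placements G \<Longrightarrow> C A \<noteq> i \<Longrightarrow> \<exists>v\<in>pverts G. guesses_correctly G f C v"
    unfolding sages_win_with_hint_def by blast
  \<comment> \<open>The sage at \<open>w\<close> imitates the preimage of \<open>w\<close> and reads
    hats through \<open>e\<close>. The restriction makes the pulled-back view extensional, as
    \<open>f\<close> expects.\<close>
  define F where "F w s = (let v = inv_into (pverts G) e w
      in f v (restrict (s \<circ> e) (neighbours G v)))" for w s
  have F: "F (e v) s = f v (restrict (s \<circ> e) (neighbours G v))" if "v \<in> pverts G" for v s
    using that inj by (simp add: F_def Let_def)
  have "F \<in> hat_strategies (relabel e G)"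
    using f by (fastforce simp: hat_strategies_def F neighbours_relabel[OF wf inj] intro!: funcsetI)
  moreover have "\<exists>w\<in>pverts (relabel e G). guesses_correctly (relabel e G) F C w"
    if C: "C \<in> hat_placements (relabel e G)" and "C (e A) \<noteq> i" for C
  proof -
    define D where "D = restrict (C \<circ> e) (pverts G)"
    have "D \<in> hat_placements G" "D A \<noteq> i"
      using C \<open>C (e A) \<noteq> i\<close> A by (auto simp: D_def hat_placements_def)
    then obtain v where v: "v \<in> pverts G" "guesses_correctly G f D v"
      using f_win by blast
    have "restrict (restrict C (e ` neighbours G v) \<circ> e) (neighbours G v)
        = restrict D (neighbours G v)"
      using neighbours_subset_pverts[OF wf] by (force simp: D_def restrict_def)
    then have "guesses_correctly (relabel e G) F C (e v)"
      using v by (simp add: guesses_correctly_def F neighbours_relabel[OF wf inj] D_def)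
    with v show ?thesis by auto
  qed
  ultimately show "\<exists>F\<in>hat_strategies (relabel e G). \<forall>C\<in>hat_placements (relabel e G).
      C (e A) \<noteq> i \<longrightarrow> (\<exists>w\<in>pverts (relabel e G). guesses_correctly (relabel e G) F C w)"
    by blast
qed

text \<open>The gluing is abstracted to three subgraphs meeting only in \<open>r\<close>. By
  \<open>local\<close>, a vertex of a part other than \<open>r\<close> sees nothing beyond its part,
  so it can play the strategy of that part unchanged; only \<open>r\<close> has to combine three
  strategies.\<close>

lemma sages_win_if_hinted_subgraphs:
  fixes G :: "'v pair_pre_digraph" and H :: "nat \<Rightarrow> 'v pair_pre_digraph"
  assumes wf: "\<And>j. j \<in> hat_colors \<Longrightarrow> pair_wf_digraph (H j)"
    and r: "\<And>j. j \<in> hat_colors \<Longrightarrow> r \<in> pverts (H j)"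
    and win: "\<And>j. j \<in> hat_colors \<Longrightarrow> sages_win_with_hint (H j) r"
    and verts: "\<And>j. j \<in> hat_colors \<Longrightarrow> pverts (H j) \<subseteq> pverts G"
    and arcs: "\<And>j. j \<in> hat_colors \<Longrightarrow> parcs (H j) \<subseteq> parcs G"
    and disj: "\<And>i j. i \<in> hat_colors \<Longrightarrow> j \<in> hat_colors \<Longrightarrow> i \<noteq> j \<Longrightarrow>
      pverts (H i) \<inter> pverts (H j) \<subseteq> {r}"
    and local: "\<And>j v. j \<in> hat_colors \<Longrightarrow> v \<in> pverts (H j) \<Longrightarrow> v \<noteq> r \<Longrightarrow>
      neighbours G v \<subseteq> neighbours (H j) v"
  shows "sages_win G"
proof -
  have "\<forall>j\<in>hat_colors. \<exists>f\<in>hat_strategies (H j). \<forall>C\<in>hat_placements (H j).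
      C r \<noteq> j \<longrightarrow> (\<exists>v\<in>pverts (H j). guesses_correctly (H j) f C v)"
    using win unfolding sages_win_with_hint_def by blast
  then obtain f where f: "\<And>j. j \<in> hat_colors \<Longrightarrow> f j \<in> hat_strategies (H j)"
    and f_win: "\<And>j C. j \<in> hat_colors \<Longrightarrow> C \<in> hat_placements (H j) \<Longrightarrow> C r \<noteq> j \<Longrightarrow>
      \<exists>v\<in>pverts (H j). guesses_correctly (H j) (f j) C v"
    by metis
  have nb_sub: "neighbours (H j) v \<subseteq> neighbours G v" if "j \<in> hat_colors" for j v
    using arcs[OF that] by (auto simp: neighbours_def)
  have nb_eq: "neighbours G v = neighbours (H j) v"
    if "j \<in> hat_colors" "v \<in> pverts (H j)" "v \<noteq> r" for j v
    using nb_sub local that by blast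
  \<comment> \<open>The index \<open>j = a\<close> is left out because the strategy of part
    \<open>j\<close> promises nothing when the hat of \<open>r\<close> is \<open>j\<close>.\<close>
  define proposes where "proposes s a \<longleftrightarrow> a \<in> hat_colors \<and>
    (\<forall>j\<in>hat_colors - {a}. f j r (restrict s (neighbours (H j) r)) = a)" for s a
  have unique: "a = b" if "proposes s a" "proposes s b" for s a b
  proof (rule ccontr)
    assume "a \<noteq> b"
    \<comment> \<open>The case split finds the third index: 0 if free, otherwise 1 if free,
      otherwise 2.\<close>
    have "\<exists>j\<in>hat_colors. j \<noteq> a \<and> j \<noteq> b"
      by (cases "a = 0 \<or> b = 0"; cases "a = 1 \<or> b = 1") (auto simp: hat_colors_def)
    then obtain j where "j \<in> hat_colors - {a}" "j \<in> hat_colors - {b}" by blast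
    with that \<open>a \<noteq> b\<close> show False by (metis proposes_def)
  qed
  \<comment> \<open>Away from \<open>r\<close> the choice is forced by \<open>disj\<close>; at
    \<open>r\<close> it is arbitrary, but \<open>F\<close> treats \<open>r\<close>
    separately.\<close>
  define part where "part v = (SOME j. j \<in> hat_colors \<and> v \<in> pverts (H j))" for v
  have part: "part v = j" if "j \<in> hat_colors" "v \<in> pverts (H j)" "v \<noteq> r" for v j
  proof -
    have "part v \<in> hat_colors \<and> v \<in> pverts (H (part v))"
      unfolding part_def by (rule someI[of _ j]) (use that in simp)
    with disj that show ?thesis by blast
  qed
  \<comment> \<open>The value 0 is only a legal default, for \<open>r\<close> without a proposal and
    for vertices outside all parts, such as the leaf.\<close>
  define F where "F v s =
    (if v = r then if Ex (proposes s) then SOME a. proposes s a else 0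
     else if \<exists>j\<in>hat_colors. v \<in> pverts (H j) then f (part v) v s else 0)" for v s
  have F_r: "F r s = a" if "proposes s a" for s a
  proof -
    have "proposes s (SOME a. proposes s a)"
      using that by (rule someI)
    with unique that show ?thesis by (auto simp: F_def)
  qed
  have F_part: "F v = f j v" if "j \<in> hat_colors" "v \<in> pverts (H j)" "v \<noteq> r" for v j
    using part[OF that] that by (auto simp: F_def fun_eq_iff)
  have zero: "0 \<in> hat_colors"
    by (simp add: hat_colors_def)
  have "F v s \<in> hat_colors"
    if v: "v \<in> pverts G" and s: "s \<in> neighbours G v \<rightarrow>\<^sub>E hat_colors" for v s
  proof (cases "v = r")
    case True
    show ?thesis
    proof (cases "Ex (proposes s)")
      case True
      then obtain a where "proposes s a" by blast
      with F_r show ?thesis using \<open>v = r\<close> by (auto simp: proposes_def)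
    next
      case False
      then show ?thesis using \<open>v = r\<close> zero by (auto simp: F_def)
    qed
  next
    case False
    show ?thesis
    proof (cases "\<exists>j\<in>hat_colors. v \<in> pverts (H j)")
      case True
      then obtain j where j: "j \<in> hat_colors" "v \<in> pverts (H j)" by blast
      with s False have "s \<in> neighbours (H j) v \<rightarrow>\<^sub>E hat_colors"
        by (simp add: nb_eq)
      with f[OF j(1)] j show ?thesis
        by (auto simp: F_part[OF j False] hat_strategies_def)
    qed (use False zero in \<open>simp add: F_def\<close>)
  qed
  then have "F \<in> hat_strategies G"
    by (auto simp: hat_strategies_def)
  moreover have "\<exists>v\<in>pverts G. guesses_correctly G F C v" if C: "C \<in> hat_placements G" for C
  proof (rule ccontr)
    assume lose: "\<not> ?thesis"
    have r_G: "r \<in> pverts G"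
      using r verts zero by blast
    have "f j r (restrict C (neighbours (H j) r)) = C r" if j: "j \<in> hat_colors - {C r}" for j
    proof -
      define D where "D = restrict C (pverts (H j))"
      have D_nb: "restrict D (neighbours (H j) v) = restrict C (neighbours (H j) v)" for v
        using neighbours_subset_pverts[OF wf, of j] j by (force simp: D_def restrict_def)
      have "D \<in> hat_placements (H j)" "D r \<noteq> j"
        using C j verts[of j] r[of j] by (auto simp: D_def hat_placements_def)
      then obtain v where v: "v \<in> pverts (H j)" "guesses_correctly (H j) (f j) D v"
        using f_win j by blast
      \<comment> \<open>Any other vertex of the part has the same view and the same guess in
        \<open>G\<close>, so its success would contradict \<open>lose\<close>.\<close>
      have "v = r"
      proof (rule ccontr)
        assume "v \<noteq> r"
        with v j have "guesses_correctly G F C v"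
          by (simp add: guesses_correctly_def D_nb F_part[of j] nb_eq[of j]) (simp add: D_def)
        with lose v verts j show False by blast
      qed
      with v show ?thesis
        by (simp add: guesses_correctly_def D_nb) (simp add: D_def)
    qed
    moreover have "C r \<in> hat_colors"
      using C r_G by (auto simp: hat_placements_def)
    \<comment> \<open>Restricting the view of \<open>r\<close> in \<open>G\<close> to its neighbours
      in \<open>H j\<close> gives its view in that part, by \<open>nb_sub\<close>.\<close>
    ultimately have "proposes (restrict C (neighbours G r)) (C r)"
      using nb_sub by (simp add: proposes_def Int_absorb1)
    then have "guesses_correctly G F C r"
      by (simp add: guesses_correctly_def F_r)
    with lose r_G show False by blast
  qed
  ultimately show ?thesis
    unfolding sages_win_def by blast
qed

lemma identify_eq_relabel: "identify S r G = relabel (\<lambda>v. if v \<in> S then r else v) G"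
  by (simp add: identify_def relabel_def Let_def)

theorem theorem11:
  fixes G0 :: "'a pair_pre_digraph" and A0 :: 'a
    and G1 :: "'b pair_pre_digraph" and A1 :: 'b
    and G2 :: "'c pair_pre_digraph" and A2 :: 'c
    and A B :: 'd
  assumes "pair_graph G0" and "A0 \<in> pverts G0" and "sages_win_with_hint G0 A0"
    and "pair_graph G1" and "A1 \<in> pverts G1" and "sages_win_with_hint G1 A1"
    and "pair_graph G2" and "A2 \<in> pverts G2" and "sages_win_with_hint G2 A2"
    and "A \<noteq> B"
  shows "sages_win (glue_with_leaf G0 A0 G1 A1 G2 A2 A B)"
proof -
  define r :: "'a + 'b + 'c + 'd" where "r = Inr (Inr (Inr A))"
  define e0 :: "'a \<Rightarrow> 'a + 'b + 'c + 'd" where "e0 v = (if v = A0 then r else Inl v)" for v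
  define e1 :: "'b \<Rightarrow> 'a + 'b + 'c + 'd" where "e1 v = (if v = A1 then r else Inr (Inl v))" for v
  define e2 :: "'c \<Rightarrow> 'a + 'b + 'c + 'd"
    where "e2 v = (if v = A2 then r else Inr (Inr (Inl v)))" for v
  define e3 :: "'d \<Rightarrow> 'a + 'b + 'c + 'd" where "e3 v = Inr (Inr (Inr v))" for v
  note e_defs = e0_def e1_def e2_def e3_def r_def
  define H where "H j = (if j = 0 then relabel e0 G0 else if j = 1 then relabel e1 G1
    else relabel e2 G2)" for j :: nat
  define G where "G = glue_with_leaf G0 A0 G1 A1 G2 A2 A B"
  define q where "q v = (if v \<in> {Inl A0, Inr (Inl A1), Inr (Inr (Inl A2)), r} then r else v)"
    for v :: "'a + 'b + 'c + 'd"
  have G_relabel: "G = relabel q (G0 \<oplus>\<^sub>G G1 \<oplus>\<^sub>G G2 \<oplus>\<^sub>G single_edge A B)"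
    unfolding G_def glue_with_leaf_def identify_eq_relabel q_def r_def ..
  \<comment> \<open>Composed with the inclusion of each summand, the quotient map becomes the
    embedding of that summand. Hence the vertices and arcs of \<open>G\<close> split into four
    images.\<close>
  have q: "q \<circ> Inl = e0" "q \<circ> (Inr \<circ> Inl) = e1" "q \<circ> (Inr \<circ> (Inr \<circ> Inl)) = e2"
    "q \<circ> (Inr \<circ> (Inr \<circ> Inr)) = e3"
    by (auto simp: fun_eq_iff q_def e_defs)
  have verts_G: "pverts G = e0 ` pverts G0 \<union> e1 ` pverts G1 \<union> e2 ` pverts G2 \<union> e3 ` {A, B}"
    unfolding G_relabel
    by (simp only: pverts_relabel disjoint_union_def pair_pre_digraph.simps image_Un image_comp
        q Un_assoc single_edge_def)
  have arcs_G: "parcs G = map_prod e0 e0 ` parcs G0 \<union> map_prod e1 e1 ` parcs G1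
      \<union> map_prod e2 e2 ` parcs G2 \<union> map_prod e3 e3 ` {(A, B), (B, A)}"
    unfolding G_relabel
    by (simp only: parcs_relabel disjoint_union_def pair_pre_digraph.simps image_Un image_comp
        map_prod.comp q Un_assoc single_edge_def)
  have wf: "pair_wf_digraph G0" "pair_wf_digraph G1" "pair_wf_digraph G2"
    using assms by (simp_all add: pair_graph_def pair_digraph_def pair_fin_digraph_def
        pair_loopfree_digraph_def)
  have wf_H: "pair_wf_digraph (H j)" for j
    using wf by (simp add: H_def pair_wf_digraph_relabel)
  have win0: "sages_win_with_hint (relabel e0 G0) (e0 A0)"
    by (rule sages_win_with_hint_relabel) (use wf assms in \<open>auto simp: e_defs inj_on_def\<close>)
  have win1: "sages_win_with_hint (relabel e1 G1) (e1 A1)"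
    by (rule sages_win_with_hint_relabel) (use wf assms in \<open>auto simp: e_defs inj_on_def\<close>)
  have win2: "sages_win_with_hint (relabel e2 G2) (e2 A2)"
    by (rule sages_win_with_hint_relabel) (use wf assms in \<open>auto simp: e_defs inj_on_def\<close>)
  have A_r: "e0 A0 = r" "e1 A1 = r" "e2 A2 = r"
    by (simp_all add: e_defs)
  have "sages_win G"
  proof (rule sages_win_if_hinted_subgraphs[of H r])
    show "pair_wf_digraph (H j)" for j by (rule wf_H)
    show "r \<in> pverts (H j)" for j
      using assms A_r[symmetric] by (simp add: H_def image_iff) metis
    show "sages_win_with_hint (H j) r" for j
      using win0 win1 win2 by (simp add: H_def A_r)
    show "pverts (H j) \<subseteq> pverts G" "parcs (H j) \<subseteq> parcs G" for j
      by (auto simp: H_def verts_G arcs_G)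
    show "pverts (H i) \<inter> pverts (H j) \<subseteq> {r}"
      if "i \<in> hat_colors" "j \<in> hat_colors" "i \<noteq> j" for i j
      using that by (auto simp: hat_colors_def H_def e_defs split: if_splits)
    \<comment> \<open>For \<open>v\<close> other than \<open>r\<close>, the sum constructors in
      \<open>v\<close> reveal its summand, and every arc of \<open>G\<close> leaving
      \<open>v\<close> comes from that summand.\<close>
    show "neighbours G v \<subseteq> neighbours (H j) v"
      if "j \<in> hat_colors" "v \<in> pverts (H j)" "v \<noteq> r" for j v
      using that unfolding neighbours_def arcs_G
      by (auto simp: hat_colors_def H_def e_defs image_iff split: if_splits)
  qed
  then show ?thesis
    by (simp add: G_def)
qed

end
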